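(* Let $\mu$ be a probability measure on a separable metric space $R$ (with its Borel $\sigma$-algebra), let $X:=\operatorname{supp}(\mu)$, and let $\mu_m:=\frac1m\sum_{j=1}^m\delta_{X_j}$, for $X_j\sim\mu$ i.i.d., be the empirical measure approximating $\mu$, supported on $m$ points. Suppose $\operatorname{ddim}(X)\le\delta$. Then $$\mathbb{E}[d_P(\mu_m,\mu)]\le\frac{2\,(4\operatorname{diam}(X))^{\delta/(\delta+2)}}{m^{1/(\delta+2)}},\qquad \operatorname{Var}[d_P(\mu_m,\mu)]\le\frac{4\,(4\operatorname{diam}(X))^{2\delta/(\delta+2)}}{m^{2/(\delta+2)}}.$$
   Context: For a metric space $R$, $A\subseteq R$ and $\varepsilon\ge0$, $A^\varepsilon:=\bigcup_{a\in A}\{y\in R: d(y,a)\le\varepsilon\}$. The Prokhorov distance of probability measures $\mu,\nu$ on $R$ is $$d_P(\mu,\nu):=\sup_{A\text{ closed}}\inf\{\varepsilon>0:\ \mu(A^\varepsilon)+\varepsilon\ge\nu(A)\text{ and }\nu(A^\varepsilon)+\varepsilon\ge\mu(A)\}.$$ The doubling dimension $\operatorname{ddim}(X)$ of a metric space $X$ is the smallest $\delta$ such that any ball of arbitrary radius $r>0$ can be covered by $\lfloor 2^\delta\rfloor$ balls of radius $r/2$. Here $\delta_{x}$ (with a point as subscript) is the Dirac measure at $x$, while the number $\delta$ is the bound on the doubling dimension. *)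

theory Defs
  imports "HOL-Probability.Probability"
begin

definition thickening :: "'a::metric_space set \<Rightarrow> real \<Rightarrow> 'a set" where
  "thickening A \<epsilon> = (\<Union>a\<in>A. cball a \<epsilon>)"

text \<open>
  Without completeness, the thickening of a closed set need not be measurable, not even for the
  completed measure. The outer measure agrees with the measure on all measurable sets. Since
  thickenings lie between \<open>{y. infdist y A < \<epsilon>}\<close> and \<open>{y. infdist y A \<le> \<epsilon>}\<close> (for nonempty
  \<open>A\<close>), any other monotone extension of the measure yields the same infimum.
\<close>

definition prokhorov_dist :: "'a::metric_space measure \<Rightarrow> 'a measure \<Rightarrow> real" where
  "prokhorov_dist \<mu> \<nu> = (SUP A\<in>{A. closed A}. Inf {\<epsilon>. \<epsilon> > 0 \<and>
     outer_measure_of \<mu> (thickening A \<epsilon>) + ennreal \<epsilon> \<ge> emeasure \<nu> A \<and>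
     outer_measure_of \<nu> (thickening A \<epsilon>) + ennreal \<epsilon> \<ge> emeasure \<mu> A})"

definition measure_support :: "'a::topological_space measure \<Rightarrow> 'a set" where
  "measure_support \<mu> = {x. \<forall>U. open U \<and> x \<in> U \<longrightarrow> emeasure \<mu> U > 0}"

text \<open>
  The set \<open>X\<close> is regarded as a metric space of its own: all balls are closed balls of \<open>X\<close>, with
  centres in \<open>X\<close>. For nonempty \<open>X\<close> the infimum, if finite, is attained, because the floor function
  is right-continuous; it is \<open>\<infinity>\<close> if \<open>X\<close> is not doubling.
\<close>

definition ddim :: "'a::metric_space set \<Rightarrow> ereal" where
  "ddim X = Inf {ereal \<delta> |\<delta>. \<forall>x\<in>X. \<forall>r>0. \<exists>C\<subseteq>X. finite C \<and> card C \<le> nat \<lfloor>2 powr \<delta>\<rfloor> \<and>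
     cball x r \<inter> X \<subseteq> (\<Union>c\<in>C. cball c (r / 2))}"

text \<open>
  An extended-valued diameter is needed because \<^const>\<open>diameter\<close> is only meaningful for bounded sets.
\<close>

definition ediam :: "'a::metric_space set \<Rightarrow> ennreal" where
  "ediam X = (SUP x\<in>X. SUP y\<in>X. ennreal (dist x y))"

text \<open>
  Powers of extended nonnegative reals, intended for exponents \<open>a \<ge> 0\<close> only. Unlike for
  \<^const>\<open>powr\<close> on the reals, \<open>0\<close> to the power \<open>0\<close> is \<open>1\<close>.
\<close>

definition ennpowr :: "ennreal \<Rightarrow> real \<Rightarrow> ennreal" where
  "ennpowr x a = (if a = 0 then 1 else if x = \<infinity> then \<infinity> else ennreal (enn2real x powr a))"

definition empirical_measure :: "nat \<Rightarrow> (nat \<Rightarrow> 'a::topological_space) \<Rightarrow> 'a measure" where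
  "empirical_measure m x = measure_of UNIV (sets borel)
     (\<lambda>A. (1 / of_nat m) * (\<Sum>j<m. emeasure (return borel (x j)) A))"

lemma sets_empirical_measure [simp]: "sets (empirical_measure m x) = sets borel"
  unfolding empirical_measure_def using sets.sigma_sets_eq[of borel] by simp

lemma emeasure_empirical_measure:
  assumes "A \<in> sets borel"
  shows "emeasure (empirical_measure m x) A
    = (1 / of_nat m) * (\<Sum>j<m. emeasure (return borel (x j)) A)"
proof (rule emeasure_measure_of[OF empirical_measure_def])
  show "positive (sets (empirical_measure m x))
      (\<lambda>A. (1 / of_nat m) * (\<Sum>j<m. emeasure (return borel (x j)) A))"
    by (simp add: positive_def)
  show "countably_additive (sets (empirical_measure m x))
      (\<lambda>A. (1 / of_nat m) * (\<Sum>j<m. emeasure (return borel (x j)) A))"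
  proof (rule countably_additiveI)
    fix F :: "nat \<Rightarrow> 'a set"
    assume F: "range F \<subseteq> sets (empirical_measure m x)" "disjoint_family F"
    have "(\<Sum>i. \<Sum>j<m. emeasure (return borel (x j)) (F i))
        = (\<Sum>j<m. \<Sum>i. emeasure (return borel (x j)) (F i))"
      by (rule suminf_sum) simp
    also have "\<dots> = (\<Sum>j<m. emeasure (return borel (x j)) (\<Union>i. F i))"
      using F by (intro sum.cong refl suminf_emeasure) auto
    finally show "(\<Sum>i. (1 / of_nat m) * (\<Sum>j<m. emeasure (return borel (x j)) (F i)))
        = (1 / of_nat m) * (\<Sum>j<m. emeasure (return borel (x j)) (\<Union>i. F i))"
      by (simp only: ennreal_suminf_cmult)
  qed
qed (use assms in auto)

end

theory Submission
  imports Defs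
begin

text \<open>
  Let \<open>D = diam X\<close>. Iterating the doubling condition \<open>k\<close> times and disjointifying splits \<open>X\<close> into
  \<open>n \<le> 2\<^bsup>\<delta>k\<^esup>\<close> Borel cells of diameter at most \<open>2D / 2\<^bsup>k\<^esup>\<close>. Replacing a closed set by the union of
  the cells it meets bounds the Prokhorov distance by the maximum of the cell diameter and the
  \<open>\<ell>\<^sup>1\<close>-distance of the cell masses. By Cauchy-Schwarz and the variance \<open>p (1 - p) / m\<close> of an empirical
  cell mass, the expected square of the latter is at most \<open>(n - 1) / m\<close>. For
  \<open>t = (4D)\<^bsup>\<delta>/(\<delta>+2)\<^esup> m\<^bsup>-1/(\<delta>+2)\<^esup>\<close>, chosen so that \<open>(4D / t)\<^bsup>\<delta>\<^esup> / m = t\<^sup>2\<close>, take \<open>k = 0\<close> if \<open>2D \<le> t\<close>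
  and otherwise \<open>t / 2 < 2D / 2\<^bsup>k\<^esup> \<le> t\<close>. The second moment is then at most \<open>2t\<^sup>2\<close>, which gives both
  claims. Measurability holds because the distance is 1-Lipschitz in the sample points.
\<close>

subsection \<open>The Prokhorov distance\<close>

text \<open>The admissible radii for one test set \<open>A\<close>. They form an up-set, which lets
  the proofs exchange bounds on the infimum for membership of a single radius.\<close>

definition prokhorov_radii :: "'a::metric_space measure \<Rightarrow> 'a measure \<Rightarrow> 'a set \<Rightarrow> real set" where
  "prokhorov_radii \<mu> \<nu> A = {\<epsilon>. \<epsilon> > 0 \<and>
     outer_measure_of \<mu> (thickening A \<epsilon>) + ennreal \<epsilon> \<ge> emeasure \<nu> A \<and>
     outer_measure_of \<nu> (thickening A \<epsilon>) + ennreal \<epsilon> \<ge> emeasure \<mu> A}"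

lemma prokhorov_dist_eq: "prokhorov_dist \<mu> \<nu> = (SUP A\<in>{A. closed A}. Inf (prokhorov_radii \<mu> \<nu> A))"
  by (simp add: prokhorov_dist_def prokhorov_radii_def)

lemma thickening_mono: "\<epsilon> \<le> \<epsilon>' \<Longrightarrow> thickening A \<epsilon> \<subseteq> thickening A \<epsilon>'"
  by (force simp: thickening_def)

lemma prokhorov_radii_mono:
  assumes "\<epsilon> \<in> prokhorov_radii \<mu> \<nu> A" "\<epsilon> \<le> \<epsilon>'"
  shows "\<epsilon>' \<in> prokhorov_radii \<mu> \<nu> A"
proof -
  have *: "outer_measure_of M (thickening A \<epsilon>) + ennreal \<epsilon>
      \<le> outer_measure_of M (thickening A \<epsilon>') + ennreal \<epsilon>'" for M :: "'a measure"
    using assms(2) by (intro add_mono outer_measure_of_mono thickening_mono ennreal_leI)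
  show ?thesis
    using assms order.trans[OF _ *] unfolding prokhorov_radii_def by auto
qed

lemma bdd_below_prokhorov_radii [simp]: "bdd_below (prokhorov_radii \<mu> \<nu> A)"
  by (rule bdd_belowI[of _ 0]) (simp add: prokhorov_radii_def)

text \<open>\<open>Inf\<close> and \<open>SUP\<close> over the reals behave as expected only on
  nonempty bounded sets. Total mass 1 makes the radius 1 admissible, so no set of radii is empty and
  all infima are at most 1.\<close>

lemma one_in_prokhorov_radii:
  assumes "prob_space \<mu>" "prob_space \<nu>"
  shows "1 \<in> prokhorov_radii \<mu> \<nu> A"
proof -
  have "emeasure \<mu> A \<le> 1" "emeasure \<nu> A \<le> 1"
    using assms prob_space.emeasure_le_1 by auto
  then show ?thesis
    by (auto simp: prokhorov_radii_def intro: add_increasing)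
qed

text \<open>Only radii strictly above \<open>c\<close> have to be checked, because the infimum need
  not be attained.\<close>

lemma prokhorov_dist_le:
  assumes "\<And>A e. closed A \<Longrightarrow> e > c \<Longrightarrow> e \<in> prokhorov_radii \<mu> \<nu> A"
  shows "prokhorov_dist \<mu> \<nu> \<le> c"
  unfolding prokhorov_dist_eq
proof (rule cSUP_least)
  fix A :: "'a set" assume "A \<in> {A. closed A}"
  then have "Inf (prokhorov_radii \<mu> \<nu> A) \<le> e" if "e > c" for e
    using that by (intro cInf_lower assms) auto
  then show "Inf (prokhorov_radii \<mu> \<nu> A) \<le> c"
    by (rule dense_ge)
qed (auto intro: closed_empty)

context
  fixes \<mu> \<nu> :: "'a::metric_space measure"
  assumes prob: "prob_space \<mu>" "prob_space \<nu>"
begin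

lemma Inf_prokhorov_radii_le_1: "Inf (prokhorov_radii \<mu> \<nu> A) \<le> 1"
  using one_in_prokhorov_radii[OF prob] by (rule cInf_lower) simp

lemma Inf_prokhorov_radii_le_dist:
  "closed A \<Longrightarrow> Inf (prokhorov_radii \<mu> \<nu> A) \<le> prokhorov_dist \<mu> \<nu>"
  unfolding prokhorov_dist_eq using Inf_prokhorov_radii_le_1
  by (intro cSUP_upper bdd_aboveI2[where M=1]) auto

lemma prokhorov_dist_nonneg: "0 \<le> prokhorov_dist \<mu> \<nu>"
proof -
  have "prokhorov_radii \<mu> \<nu> {} \<noteq> {}"
    using one_in_prokhorov_radii[OF prob] by blast
  then have "0 \<le> Inf (prokhorov_radii \<mu> \<nu> {})"
    by (rule cInf_greatest) (simp add: prokhorov_radii_def)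
  then show ?thesis
    using Inf_prokhorov_radii_le_dist[of "{}"] by simp
qed

lemma prokhorov_dist_le_1: "prokhorov_dist \<mu> \<nu> \<le> 1"
  using prokhorov_radii_mono[OF one_in_prokhorov_radii[OF prob]]
  by (intro prokhorov_dist_le) simp

text \<open>Converse of \<open>prokhorov_dist_le\<close>: strictness yields an admissible radius
  below \<open>e\<close>, and admissibility passes to larger radii.\<close>

lemma prokhorov_dist_less_imp:
  assumes "prokhorov_dist \<mu> \<nu> < e" "closed A"
  shows "e \<in> prokhorov_radii \<mu> \<nu> A"
proof -
  have "Inf (prokhorov_radii \<mu> \<nu> A) < e"
    using assms Inf_prokhorov_radii_le_dist by fastforce
  then obtain e' where "e' \<in> prokhorov_radii \<mu> \<nu> A" "e' < e"
    using cInf_lessD[of "prokhorov_radii \<mu> \<nu> A" e] one_in_prokhorov_radii[OF prob, of A] by auto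
  then show ?thesis
    using prokhorov_radii_mono by fastforce
qed

end

section \<open>Comparison of two measures through a finite partition\<close>

text \<open>Let \<open>B\<close> be the union of the cells that meet \<open>A\<close>. It contains
  \<open>A\<close> up to a \<open>\<mu>\<close>-null set, lies within \<open>e\<close> of
  \<open>A\<close> since the cells are small, and its two masses differ by at most the total
  deviation of the cell masses. The same \<open>e\<close> thus serves as thickening radius and as
  additive error.\<close>

lemma emeasure_le_outer_thickening:
  fixes \<mu> \<nu> :: "'a::metric_space measure"
  assumes "prob_space \<mu>" "prob_space \<nu>" and sets: "sets \<mu> = sets borel" "sets \<nu> = sets borel"
    and F: "finite I" "disjoint_family_on F I" "\<And>i. i \<in> I \<Longrightarrow> F i \<in> sets borel"
    and null: "emeasure \<mu> (- (\<Union>i\<in>I. F i)) = 0"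
    and small: "\<And>i x y. i \<in> I \<Longrightarrow> x \<in> F i \<Longrightarrow> y \<in> F i \<Longrightarrow> dist x y \<le> e"
    and A: "A \<in> sets borel" and e: "(\<Sum>i\<in>I. \<bar>measure \<mu> (F i) - measure \<nu> (F i)\<bar>) \<le> e"
  shows "emeasure \<mu> A \<le> outer_measure_of \<nu> (thickening A e) + ennreal e"
proof -
  interpret \<mu>: prob_space \<mu> by fact
  interpret \<nu>: prob_space \<nu> by fact
  define J where "J = {i\<in>I. F i \<inter> A \<noteq> {}}"
  define B where "B = (\<Union>i\<in>J. F i)"
  have J: "finite J" "J \<subseteq> I"
    using F by (auto simp: J_def)
  have FJ: "F i \<in> sets borel" if "i \<in> J" for i
    using that J F by auto
  have disj: "disjoint_family_on F J"
    using F(2) J(2) by (rule disjoint_family_on_mono[rotated])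
  have B: "B \<in> sets borel"
    unfolding B_def using J FJ by (intro sets.finite_UN) auto
  have sum_B: "measure M B = (\<Sum>i\<in>J. measure M (F i))" if "prob_space M" "sets M = sets borel" for M
  proof -
    interpret prob_space M by fact
    show ?thesis
      unfolding B_def using J disj FJ that(2)
      by (intro finite_measure_finite_Union) auto
  qed
  have e0: "0 \<le> e"
    using e by (rule order.trans[rotated]) (simp add: sum_nonneg)
  \<comment> \<open>Each cell in \<open>B\<close> contains a point of \<open>A\<close>, and all
    other points of the cell are within \<open>e\<close> of it.\<close>
  have B_thick: "B \<subseteq> thickening A e"
    using small by (fastforce simp: B_def J_def thickening_def)
  have rest: "- (\<Union>i\<in>I. F i) \<in> sets borel"
    using F by (intro borel_comp sets.finite_UN) auto
  have "emeasure \<mu> A \<le> emeasure \<mu> (B \<union> - (\<Union>i\<in>I. F i))"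
    using B rest sets by (intro emeasure_mono) (auto simp: B_def J_def)
  also have "\<dots> \<le> emeasure \<mu> B + emeasure \<mu> (- (\<Union>i\<in>I. F i))"
    using B rest sets by (intro emeasure_subadditive) simp_all
  also have "\<dots> = ennreal (measure \<mu> B)"
    using null by (simp add: \<mu>.emeasure_eq_measure)
  also have "\<dots> \<le> ennreal (measure \<nu> B + e)"
  proof (rule ennreal_leI)
    have "measure \<mu> B - measure \<nu> B = (\<Sum>i\<in>J. measure \<mu> (F i) - measure \<nu> (F i))"
      using sum_B[of \<mu>] sum_B[of \<nu>] assms by (simp add: sum_subtractf)
    also have "\<dots> \<le> (\<Sum>i\<in>J. \<bar>measure \<mu> (F i) - measure \<nu> (F i)\<bar>)"
      by (intro sum_mono) auto
    also have "\<dots> \<le> (\<Sum>i\<in>I. \<bar>measure \<mu> (F i) - measure \<nu> (F i)\<bar>)"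
      using F(1) J by (intro sum_mono2) auto
    finally show "measure \<mu> B \<le> measure \<nu> B + e"
      using e by linarith
  qed
  \<comment> \<open>\<open>B\<close> is Borel, so measure and outer measure agree; the passage to
    outer measure happens here because the thickening itself may be non-measurable.\<close>
  also have "\<dots> = outer_measure_of \<nu> B + ennreal e"
    using B sets e0 by (simp add: \<nu>.emeasure_eq_measure)
  also have "\<dots> \<le> outer_measure_of \<nu> (thickening A e) + ennreal e"
    using B_thick by (intro add_mono outer_measure_of_mono) auto
  finally show ?thesis .
qed

lemma prokhorov_dist_le_partition:
  fixes \<mu> \<nu> :: "'a::metric_space measure"
  assumes prob: "prob_space \<mu>" "prob_space \<nu>" and sets: "sets \<mu> = sets borel" "sets \<nu> = sets borel"
    and F: "finite I" "disjoint_family_on F I" "\<And>i. i \<in> I \<Longrightarrow> F i \<in> sets borel"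
    and null: "emeasure \<mu> (- (\<Union>i\<in>I. F i)) = 0" "emeasure \<nu> (- (\<Union>i\<in>I. F i)) = 0"
    and small: "\<And>i x y. i \<in> I \<Longrightarrow> x \<in> F i \<Longrightarrow> y \<in> F i \<Longrightarrow> dist x y \<le> \<epsilon>"
    and "0 \<le> \<epsilon>"
  shows "prokhorov_dist \<mu> \<nu> \<le> max \<epsilon> (\<Sum>i\<in>I. \<bar>measure \<mu> (F i) - measure \<nu> (F i)\<bar>)"
proof (rule prokhorov_dist_le)
  fix A :: "'a set" and e
  assume "closed A" and e: "e > max \<epsilon> (\<Sum>i\<in>I. \<bar>measure \<mu> (F i) - measure \<nu> (F i)\<bar>)"
  then have A: "A \<in> sets borel" and small': "\<And>i x y. i \<in> I \<Longrightarrow> x \<in> F i \<Longrightarrow> y \<in> F i \<Longrightarrow> dist x y \<le> e"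
    using small by fastforce+
  have "emeasure \<mu> A \<le> outer_measure_of \<nu> (thickening A e) + ennreal e"
    using e by (intro emeasure_le_outer_thickening[OF prob sets F null(1) small' A]) auto
  moreover have "emeasure \<nu> A \<le> outer_measure_of \<mu> (thickening A e) + ennreal e"
    using e by (intro emeasure_le_outer_thickening[OF prob(2,1) sets(2,1) F null(2) small' A])
      (auto simp: abs_minus_commute)
  ultimately show "e \<in> prokhorov_radii \<mu> \<nu> A"
    using e \<open>0 \<le> \<epsilon>\<close> by (simp add: prokhorov_radii_def)
qed

subsection \<open>Empirical measures\<close>

lemma prob_space_empirical_measure:
  assumes "m \<ge> 1"
  shows "prob_space (empirical_measure m x)"
proof
  have "space (empirical_measure m x) = UNIV"
    by (simp add: empirical_measure_def space_measure_of_conv)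
  then have "emeasure (empirical_measure m x) (space (empirical_measure m x)) = 1 / of_nat m * of_nat m"
    by (simp add: emeasure_empirical_measure)
  also have "\<dots> = 1"
    using assms by (simp add: ennreal_divide_times ennreal_of_nat_eq_real_of_nat divide_ennreal
        flip: ennreal_1 ennreal_mult')
  finally show "emeasure (empirical_measure m x) (space (empirical_measure m x)) = 1" .
qed

lemma emeasure_empirical_measure_eq:
  assumes "A \<in> sets borel" "m \<ge> 1"
  shows "emeasure (empirical_measure m x) A = ennreal ((\<Sum>j<m. indicat_real A (x j)) / m)"
proof -
  have "(\<Sum>j<m. emeasure (return borel (x j)) A) = ennreal (\<Sum>j<m. indicat_real A (x j))"
    using assms by (simp add: ennreal_indicator flip: sum_ennreal)
  then show ?thesis
    using assms by (simp add: emeasure_empirical_measure ennreal_divide_times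
        ennreal_of_nat_eq_real_of_nat divide_ennreal sum_nonneg)
qed

lemma measure_empirical_measure:
  assumes "A \<in> sets borel" "m \<ge> 1"
  shows "measure (empirical_measure m x) A = (\<Sum>j<m. indicat_real A (x j)) / m"
  by (simp add: measure_def emeasure_empirical_measure_eq[OF assms] sum_nonneg)

text \<open>A finitely supported measure sees a set only through the sample points in it. Finite
  sets are closed in a T1 space, so even a non-measurable \<open>A\<close> has a Borel superset with
  the same sample points.\<close>

lemma outer_measure_of_empirical_measure:
  fixes x :: "nat \<Rightarrow> 'a::t1_space"
  assumes "m \<ge> 1"
  shows "outer_measure_of (empirical_measure m x) A = ennreal ((\<Sum>j<m. indicat_real A (x j)) / m)"
proof -
  \<comment> \<open>The largest superset of \<open>A\<close> that contains no further sample
    points.\<close>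
  define E where "E = - {x j |j. j < m \<and> x j \<notin> A}"
  have "finite {x j |j. j < m \<and> x j \<notin> A}"
    by simp
  then have E: "E \<in> sets borel"
    unfolding E_def by (intro borel_comp borel_closed finite_imp_closed)
  have eq: "(\<Sum>j<m. indicat_real E (x j)) = (\<Sum>j<m. indicat_real A (x j))"
    by (intro sum.cong) (auto simp: E_def indicator_def)
  show ?thesis
    unfolding outer_measure_of_def
  proof (rule antisym)
    have "(INF B\<in>{B \<in> sets (empirical_measure m x). A \<subseteq> B}. emeasure (empirical_measure m x) B)
        \<le> emeasure (empirical_measure m x) E"
      using E by (intro INF_lower) (auto simp: E_def)
    then show "(INF B\<in>{B \<in> sets (empirical_measure m x). A \<subseteq> B}. emeasure (empirical_measure m x) B)
        \<le> ennreal ((\<Sum>j<m. indicat_real A (x j)) / m)"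
      using emeasure_empirical_measure_eq[OF E assms, of x] eq by simp
  next
    have "(\<Sum>j<m. indicat_real A (x j)) \<le> (\<Sum>j<m. indicat_real B (x j))" if "A \<subseteq> B" for B
      using that by (intro sum_mono) (auto simp: indicator_def)
    then show "ennreal ((\<Sum>j<m. indicat_real A (x j)) / m)
        \<le> (INF B\<in>{B \<in> sets (empirical_measure m x). A \<subseteq> B}. emeasure (empirical_measure m x) B)"
      using assms
      by (intro INF_greatest) (auto simp: emeasure_empirical_measure_eq intro!: ennreal_leI divide_right_mono)
  qed
qed

section \<open>Stability under displacement of the sample, and measurability\<close>

lemma closed_infdist_le: "closed {x. infdist x A \<le> c}"
  by (intro closed_Collect_le continuous_intros)

text \<open>The distance to \<open>A\<close> need not be attained. The strict slack between
  \<open>\<epsilon> + \<eta>\<close> and \<open>e\<close> provides an actual point of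
  \<open>A\<close>.\<close>

lemma thickening_infdist_le:
  assumes "A \<noteq> {}" "\<epsilon> + \<eta> < e"
  shows "thickening {x. infdist x A \<le> \<eta>} \<epsilon> \<subseteq> thickening A e"
proof
  fix y assume "y \<in> thickening {x. infdist x A \<le> \<eta>} \<epsilon>"
  then obtain x where x: "infdist x A \<le> \<eta>" "dist x y \<le> \<epsilon>"
    by (auto simp: thickening_def)
  then have "infdist x A < e - \<epsilon>"
    using assms by linarith
  then obtain a where "a \<in> A" "dist x a < e - \<epsilon>"
    using assms(1) by (auto simp: infdist_def cINF_less_iff)
  then have "dist a y \<le> e"
    using x dist_triangle[of a y x] by (simp add: dist_commute)
  then show "y \<in> thickening A e"
    using \<open>a \<in> A\<close> by (auto simp: thickening_def)
qed

text \<open>The two inequalities need different test sets for the sample \<open>x\<close>. For the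
  mass \<open>\<mu>\<close> gives to \<open>A\<close>, the set \<open>A\<close> itself works: sample
  points within \<open>\<epsilon>\<close> of \<open>A\<close> move to within
  \<open>\<epsilon> + \<eta>\<close>. For the empirical mass of \<open>A\<close> under
  \<open>y\<close>, the set is enlarged first: if \<open>y j\<close> lies in \<open>A\<close>, then
  \<open>x j\<close> lies in the closed \<open>\<eta>\<close>-neighbourhood of
  \<open>A\<close>.\<close>

lemma prokhorov_dist_empirical_le:
  fixes \<mu> :: "'a::metric_space measure"
  assumes \<mu>: "prob_space \<mu>" and m: "m \<ge> 1"
    and close: "\<And>j. j < m \<Longrightarrow> dist (x j) (y j) \<le> \<eta>"
  shows "prokhorov_dist (empirical_measure m y) \<mu> \<le> prokhorov_dist (empirical_measure m x) \<mu> + \<eta>"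
proof (rule prokhorov_dist_le)
  fix A :: "'a set" and e
  assume A: "closed A" and e: "e > prokhorov_dist (empirical_measure m x) \<mu> + \<eta>"
  let ?emp = "empirical_measure m"
  have "0 \<le> \<eta>"
    using close[of 0] m zero_le_dist[of "x 0" "y 0"] by linarith
  have "0 \<le> prokhorov_dist (?emp x) \<mu>"
    by (intro prokhorov_dist_nonneg prob_space_empirical_measure \<mu> m)
  \<comment> \<open>The room left below \<open>e\<close> is the slack demanded by
    \<open>thickening_infdist_le\<close>.\<close>
  obtain \<epsilon> where \<epsilon>: "prokhorov_dist (?emp x) \<mu> < \<epsilon>" "\<epsilon> + \<eta> < e"
    using dense[of "prokhorov_dist (?emp x) \<mu>" "e - \<eta>"] e by (auto simp: algebra_simps)
  have "0 < \<epsilon>"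
    using \<epsilon> \<open>0 \<le> prokhorov_dist (?emp x) \<mu>\<close> by simp
  \<comment> \<open>Defined by \<open>infdist\<close> and not as \<open>thickening A \<eta>\<close>,
    since a test set must be closed and a thickening may fail to be.\<close>
  define A' where "A' = {z. infdist z A \<le> \<eta>}"
  have radii: "\<epsilon> \<in> prokhorov_radii (?emp x) \<mu> C" if "closed C" for C
    using that \<epsilon>(1) by (intro prokhorov_dist_less_imp prob_space_empirical_measure \<mu> m)
  show "e \<in> prokhorov_radii (?emp y) \<mu> A"
  \<comment> \<open>By convention \<open>infdist z {}\<close> is 0, so for empty \<open>A\<close>
    the set \<open>A'\<close> would be the whole space.\<close>
  proof (cases "A = {}")
    case True
    then show ?thesis
      using \<epsilon> \<open>0 < \<epsilon>\<close> \<open>0 \<le> \<eta>\<close> by (simp add: prokhorov_radii_def)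
  next
    case False
    have "emeasure \<mu> A \<le> outer_measure_of (?emp x) (thickening A \<epsilon>) + ennreal \<epsilon>"
      using radii[OF A] by (simp add: prokhorov_radii_def)
    also have "outer_measure_of (?emp x) (thickening A \<epsilon>) \<le> outer_measure_of (?emp y) (thickening A e)"
    proof -
      have "y j \<in> thickening A e" if xj: "x j \<in> thickening A \<epsilon>" and j: "j < m" for j
      proof -
        obtain a where "a \<in> A" "dist a (x j) \<le> \<epsilon>"
          using xj by (auto simp: thickening_def)
        moreover have "dist a (y j) \<le> dist a (x j) + dist (x j) (y j)"
          by (rule dist_triangle)
        ultimately show ?thesis
          using close[OF j] \<epsilon>(2) by (force simp: thickening_def)
      qed
      then show ?thesis
        unfolding outer_measure_of_empirical_measure[OF m]
        by (intro ennreal_leI divide_right_mono sum_mono) (auto simp: indicator_def)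
    qed
    finally have 1: "emeasure \<mu> A \<le> outer_measure_of (?emp y) (thickening A e) + ennreal \<epsilon>"
      by (simp add: add_mono)
    have "emeasure (?emp y) A \<le> emeasure (?emp x) A'"
    proof -
      have "x j \<in> A'" if "y j \<in> A" "j < m" for j
        using close[of j] that infdist_le[of "y j" A "x j"] by (simp add: A'_def)
      then have "(\<Sum>j<m. indicat_real A (y j)) \<le> (\<Sum>j<m. indicat_real A' (x j))"
        by (intro sum_mono) (auto simp: indicator_def)
      moreover have "A \<in> sets borel" "A' \<in> sets borel"
        using A borel_closed[OF closed_infdist_le] by (auto simp: A'_def)
      ultimately show ?thesis
        using m by (simp only: emeasure_empirical_measure_eq) (intro ennreal_leI divide_right_mono, simp_all)
    qed
    also have "\<dots> \<le> outer_measure_of \<mu> (thickening A' \<epsilon>) + ennreal \<epsilon>"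
      using radii[OF closed_infdist_le, of A \<eta>] by (simp add: prokhorov_radii_def A'_def)
    also have "outer_measure_of \<mu> (thickening A' \<epsilon>) \<le> outer_measure_of \<mu> (thickening A e)"
      unfolding A'_def by (intro outer_measure_of_mono thickening_infdist_le False \<epsilon>)
    finally have 2: "emeasure (?emp y) A \<le> outer_measure_of \<mu> (thickening A e) + ennreal \<epsilon>"
      by (simp add: add_mono)
    have "ennreal \<epsilon> \<le> ennreal e"
      using \<epsilon> \<open>0 \<le> \<eta>\<close> by (intro ennreal_leI) simp
    then show ?thesis
      using 1 2 \<epsilon> \<open>0 < \<epsilon>\<close> \<open>0 \<le> \<eta>\<close> unfolding prokhorov_radii_def
      by (auto intro: order.trans add_left_mono)
  qed
qed

text \<open>Continuity is meant in the product topology on sequences. Only the first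
  \<open>m\<close> coordinates enter, so the condition that they move by less than
  \<open>e / 2\<close> defines an open cylinder.\<close>

lemma continuous_prokhorov_dist_empirical:
  fixes \<mu> :: "'a::metric_space measure"
  assumes \<mu>: "prob_space \<mu>" and m: "m \<ge> 1"
  shows "continuous_on UNIV (\<lambda>x. prokhorov_dist (empirical_measure m x) \<mu>)"
proof -
  let ?d = "\<lambda>x. prokhorov_dist (empirical_measure m x) \<mu>"
  have "(?d \<longlongrightarrow> ?d x) (nhds x)" for x :: "nat \<Rightarrow> 'a"
  proof (rule tendstoI)
    fix e :: real assume "e > 0"
    define U where "U = {y. \<forall>j\<in>{..<m}. y j \<in> ball (x j) (e / 2)}"
    have "open U"
      unfolding U_def by (intro product_topology_basis') auto
    moreover have "x \<in> U"
      using \<open>e > 0\<close> by (simp add: U_def)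
    moreover have "dist (?d y) (?d x) < e" if "y \<in> U" for y
    proof -
      have "?d y \<le> ?d x + e / 2" "?d x \<le> ?d y + e / 2"
        using that by (intro prokhorov_dist_empirical_le \<mu> m; force simp: U_def dist_commute)+
      then show ?thesis
        using \<open>e > 0\<close> by (simp add: dist_real_def)
    qed
    ultimately show "\<forall>\<^sub>F y in nhds x. dist (?d y) (?d x) < e"
      unfolding eventually_nhds by blast
  qed
  then show ?thesis
    unfolding continuous_on_def by (blast intro: tendsto_mono[OF at_within_le_nhds])
qed

lemma empirical_measure_cong:
  assumes "\<And>j. j < m \<Longrightarrow> x j = y j"
  shows "empirical_measure m x = empirical_measure m y"
  using assms by (intro measure_eqI) (auto simp: emeasure_empirical_measure)

text \<open>Second countability makes a coordinatewise measurable map into the sequence space Borel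
  measurable; the distance is then a continuous function of it.\<close>

lemma borel_measurable_prokhorov_dist_empirical:
  fixes \<mu> :: "'a::{metric_space, second_countable_topology} measure"
  assumes \<mu>: "prob_space \<mu>" and m: "m \<ge> 1"
    and X: "\<And>j. j < m \<Longrightarrow> X j \<in> borel_measurable P"
  shows "(\<lambda>\<omega>. prokhorov_dist (empirical_measure m (\<lambda>j. X j \<omega>)) \<mu>) \<in> borel_measurable P"
proof -
  \<comment> \<open>\<open>X j\<close> may fail to be measurable for \<open>j \<ge> m\<close>.\<close>
  define Y where "Y \<omega> j = (if j < m then X j \<omega> else X 0 \<omega>)" for \<omega> j
  have "Y \<in> borel_measurable P"
  proof (rule measurable_coordinatewise_then_product)
    show "(\<lambda>\<omega>. Y \<omega> j) \<in> borel_measurable P" for j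
      using X[of j] X[of 0] m by (cases "j < m") (auto simp: Y_def)
  qed
  then have "(\<lambda>\<omega>. prokhorov_dist (empirical_measure m (Y \<omega>)) \<mu>) \<in> borel_measurable P"
    by (rule measurable_compose)
      (intro borel_measurable_continuous_onI continuous_prokhorov_dist_empirical \<mu> m)
  moreover have "empirical_measure m (Y \<omega>) = empirical_measure m (\<lambda>j. X j \<omega>)" for \<omega>
    by (rule empirical_measure_cong) (simp add: Y_def)
  ultimately show ?thesis
    by simp
qed

subsection \<open>Support and doubling dimension\<close>

lemma closed_measure_support: "closed (measure_support \<mu>)"
proof -
  have "- measure_support \<mu> = \<Union>{U. open U \<and> emeasure \<mu> U = 0}"
    by (auto simp: measure_support_def)
  then have "open (- measure_support \<mu>)"
    by (auto intro: open_Union)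
  then show ?thesis
    by (simp add: closed_def)
qed

text \<open>The complement of the support is a union of null open sets, possibly uncountable. A
  countable basis reduces it to countably many null basis sets.\<close>

lemma emeasure_Compl_measure_support:
  fixes \<mu> :: "'a::second_countable_topology measure"
  assumes "sets \<mu> = sets borel"
  shows "emeasure \<mu> (- measure_support \<mu>) = 0"
proof -
  obtain B :: "'a set set" where B: "countable B" "topological_basis B"
    using ex_countable_basis by blast
  define N where "N = {b\<in>B. emeasure \<mu> b = 0}"
  have "x \<in> \<Union>N" if x: "x \<notin> measure_support \<mu>" for x
  proof -
    obtain U where U: "open U" "x \<in> U" "emeasure \<mu> U = 0"
      using x by (auto simp: measure_support_def)
    then obtain b where b: "b \<in> B" "x \<in> b" "b \<subseteq> U"
      using B(2) by (metis topological_basisE)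
    then have "emeasure \<mu> b = 0"
      using U assms emeasure_mono[of b U \<mu>] by simp
    then show ?thesis
      using b by (auto simp: N_def)
  qed
  then have sub: "- measure_support \<mu> \<subseteq> \<Union>N"
    by blast
  have "(\<Union>b\<in>N. b) \<in> null_sets \<mu>"
    using B assms
    by (intro null_sets_UN') (auto simp: N_def null_sets_def topological_basis_open)
  then show ?thesis
    using sub null_sets_subset[of "\<Union>N" \<mu> "- measure_support \<mu>"] closed_measure_support[of \<mu>] assms
    by auto
qed

lemma emeasure_measure_support:
  fixes \<mu> :: "'a::second_countable_topology measure"
  assumes "prob_space \<mu>" and sets: "sets \<mu> = sets borel"
  shows "emeasure \<mu> (measure_support \<mu>) = 1"
proof -
  interpret prob_space \<mu> by fact
  have "space \<mu> = UNIV"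
    using sets_eq_imp_space_eq[OF sets] by simp
  moreover have "emeasure \<mu> (space \<mu> - (- measure_support \<mu>)) = emeasure \<mu> (space \<mu>) - 0"
    using closed_measure_support[of \<mu>] sets
    by (subst emeasure_compl) (simp_all add: emeasure_Compl_measure_support)
  ultimately show ?thesis
    using emeasure_space_1 by simp
qed

section \<open>Doubling covers and partitions into small cells\<close>

text \<open>\<open>ddim\<close> is an infimum, so a priori only exponents \<open>e\<close> slightly
  above \<open>\<delta>\<close> are admissible. By continuity \<open>2 powr e\<close> stays below
  the next integer after \<open>2 powr \<delta>\<close>, so both exponents allow the same number of
  balls.\<close>

lemma ddim_le_imp_cover:
  assumes "ddim X \<le> ereal \<delta>" "x \<in> X" "r > 0"
  shows "\<exists>C\<subseteq>X. finite C \<and> card C \<le> nat \<lfloor>2 powr \<delta>\<rfloor> \<and>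
    cball x r \<inter> X \<subseteq> (\<Union>c\<in>C. cball c (r / 2))"
proof -
  have "((\<lambda>e. 2 powr e) \<longlongrightarrow> 2 powr \<delta>) (at_right \<delta>)"
    by (intro tendsto_intros) auto
  then have "\<forall>\<^sub>F e in at_right \<delta>. (2::real) powr e < of_int (\<lfloor>2 powr \<delta>\<rfloor> + 1)"
    by (rule order_tendstoD) linarith
  then obtain b where b: "b > \<delta>" "\<And>e. \<delta> < e \<Longrightarrow> e < b \<Longrightarrow> (2::real) powr e < of_int (\<lfloor>2 powr \<delta>\<rfloor> + 1)"
    unfolding eventually_at_right_field by blast
  have "ddim X < ereal b"
    using assms(1) b(1) by (simp add: order.strict_trans1)
  then obtain e where "e < b" and cover: "\<forall>x\<in>X. \<forall>r>0. \<exists>C\<subseteq>X. finite C \<and>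
      card C \<le> nat \<lfloor>2 powr e\<rfloor> \<and> cball x r \<inter> X \<subseteq> (\<Union>c\<in>C. cball c (r / 2))"
    unfolding ddim_def Inf_less_iff by auto
  have "(2::real) powr e < of_int (\<lfloor>2 powr \<delta>\<rfloor> + 1)"
  proof (cases "e \<le> \<delta>")
    case True
    then have "(2::real) powr e \<le> 2 powr \<delta>"
      by simp
    then show ?thesis
      by linarith
  qed (use b \<open>e < b\<close> in simp)
  then have "nat \<lfloor>2 powr e\<rfloor> \<le> nat \<lfloor>2 powr \<delta>\<rfloor>"
    by (intro nat_mono) linarith
  then show ?thesis
    using cover[rule_format, OF assms(2,3)] by (meson order.trans)
qed

text \<open>The covering balls have centres in \<open>X\<close>, so the doubling condition applies
  to each of them again; every round halves the radius and multiplies the count by the same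
  factor.\<close>

lemma ddim_le_imp_iterated_cover:
  assumes "ddim X \<le> ereal \<delta>" "x \<in> X" "r > 0"
  shows "\<exists>C\<subseteq>X. finite C \<and> card C \<le> nat \<lfloor>2 powr \<delta>\<rfloor> ^ k \<and>
    cball x r \<inter> X \<subseteq> (\<Union>c\<in>C. cball c (r / 2 ^ k))"
proof (induction k)
  case 0
  show ?case
    using assms by (intro exI[of _ "{x}"]) auto
next
  case (Suc k)
  then obtain C where C: "C \<subseteq> X" "finite C" "card C \<le> nat \<lfloor>2 powr \<delta>\<rfloor> ^ k"
      "cball x r \<inter> X \<subseteq> (\<Union>c\<in>C. cball c (r / 2 ^ k))"
    by blast
  have "\<exists>D\<subseteq>X. finite D \<and> card D \<le> nat \<lfloor>2 powr \<delta>\<rfloor> \<and>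
      cball c (r / 2 ^ k) \<inter> X \<subseteq> (\<Union>d\<in>D. cball d (r / 2 ^ k / 2))" if "c \<in> C" for c
    using that C(1) assms(3) by (intro ddim_le_imp_cover[OF assms(1)]) auto
  then obtain D where D: "\<And>c. c \<in> C \<Longrightarrow> D c \<subseteq> X \<and> finite (D c) \<and> card (D c) \<le> nat \<lfloor>2 powr \<delta>\<rfloor> \<and>
      cball c (r / 2 ^ k) \<inter> X \<subseteq> (\<Union>d\<in>D c. cball d (r / 2 ^ k / 2))"
    by metis
  have "card (\<Union>c\<in>C. D c) \<le> (\<Sum>c\<in>C. card (D c))"
    by (rule card_UN_le[OF C(2)])
  also have "\<dots> \<le> (\<Sum>c\<in>C. nat \<lfloor>2 powr \<delta>\<rfloor>)"
    using D by (intro sum_mono) auto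
  also have "\<dots> = nat \<lfloor>2 powr \<delta>\<rfloor> * card C"
    by simp
  also have "\<dots> \<le> nat \<lfloor>2 powr \<delta>\<rfloor> ^ Suc k"
    using C(3) by simp
  finally have card: "card (\<Union>c\<in>C. D c) \<le> nat \<lfloor>2 powr \<delta>\<rfloor> ^ Suc k" .
  have "cball x r \<inter> X \<subseteq> (\<Union>c\<in>C. cball c (r / 2 ^ k) \<inter> X)"
    using C(4) by blast
  also have "\<dots> \<subseteq> (\<Union>c\<in>C. \<Union>d\<in>D c. cball d (r / 2 ^ k / 2))"
    using D by (intro UN_mono) auto
  finally have "cball x r \<inter> X \<subseteq> (\<Union>d\<in>(\<Union>c\<in>C. D c). cball d (r / 2 ^ Suc k))"
    by (simp add: field_simps)
  moreover have "(\<Union>c\<in>C. D c) \<subseteq> X" "finite (\<Union>c\<in>C. D c)"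
    using C(2) D by auto
  ultimately show ?case
    using card by blast
qed

text \<open>A negative exponent would allow 0 balls, which cannot cover the centre of a
  ball.\<close>

lemma ddim_le_imp_nonneg:
  assumes "ddim X \<le> ereal \<delta>" "X \<noteq> {}"
  shows "0 \<le> \<delta>"
proof (rule ccontr)
  assume "\<not> 0 \<le> \<delta>"
  then have "(2::real) powr \<delta> < 2 powr 0"
    by (intro powr_less_mono) auto
  then have "\<lfloor>(2::real) powr \<delta>\<rfloor> < 1"
    by (simp add: floor_less_iff)
  moreover obtain x where "x \<in> X"
    using assms(2) by blast
  then obtain C where "finite C" "card C \<le> nat \<lfloor>2 powr \<delta>\<rfloor>" "cball x 1 \<inter> X \<subseteq> (\<Union>c\<in>C. cball c (1 / 2))"
    using ddim_le_imp_cover[OF assms(1) \<open>x \<in> X\<close> zero_less_one] by (elim exE conjE) (rule that)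
  ultimately have "cball x 1 \<inter> X = {}"
    by simp
  moreover have "x \<in> cball x 1 \<inter> X"
    using \<open>x \<in> X\<close> by simp
  ultimately show False
    by blast
qed

text \<open>Exponent 0 allows a single ball in each cover. This rules out
  \<open>\<delta> = 0\<close> when the support has infinite diameter.\<close>

lemma ddim_le_0_imp_eq:
  assumes "ddim X \<le> 0" "x \<in> X" "y \<in> X"
  shows "x = y"
proof (rule ccontr)
  assume "x \<noteq> y"
  define r where "r = dist x y"
  have "r > 0"
    using \<open>x \<noteq> y\<close> by (simp add: r_def)
  have "ddim X \<le> ereal 0"
    using assms(1) by (simp add: zero_ereal_def)
  \<comment> \<open>Two halvings are used: one ball of radius \<open>r / 2\<close> may contain two
    points at distance \<open>r\<close>, but one of radius \<open>r / 4\<close> cannot.\<close>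
  from ddim_le_imp_iterated_cover[OF this assms(2) \<open>r > 0\<close>, of 2]
  obtain C where C: "finite C" "card C \<le> 1" "cball x r \<inter> X \<subseteq> (\<Union>c\<in>C. cball c (r / 4))"
    by auto
  have "x \<in> cball x r \<inter> X" "y \<in> cball x r \<inter> X"
    using assms \<open>r > 0\<close> by (auto simp: r_def)
  then obtain c d where "c \<in> C" "d \<in> C" "dist c x \<le> r / 4" "dist d y \<le> r / 4"
    using subsetD[OF C(3), of x] subsetD[OF C(3), of y] by auto
  moreover have "c = d"
    using calculation C(1,2) card_le_Suc0_iff_eq[of C] by auto
  ultimately show False
    using dist_triangle[of x y c] dist_commute[of x c] \<open>r > 0\<close> r_def by force
qed

text \<open>\<open>X\<close> lies in the ball of radius \<open>D\<close> about any of its points.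
  The balls of the \<open>k\<close>-fold iterated cover, cut with the closed set \<open>X\<close>,
  become the cells once overlaps are removed; the factor 2 is diameter against radius.\<close>

lemma ddim_le_imp_partition:
  fixes X :: "'a::metric_space set"
  assumes "ddim X \<le> ereal \<delta>" "closed X" "X \<noteq> {}" "0 \<le> D"
    and D: "\<And>x y. x \<in> X \<Longrightarrow> y \<in> X \<Longrightarrow> dist x y \<le> D"
  obtains F n where "real n \<le> 2 powr (\<delta> * real k)" "disjoint_family_on F {..<n}" "(\<Union>i<n. F i) = X"
    "\<And>i. F i \<in> sets borel" "\<And>i x y. x \<in> F i \<Longrightarrow> y \<in> F i \<Longrightarrow> dist x y \<le> 2 * D / 2 ^ k"
proof (cases "D = 0")
  \<comment> \<open>The doubling condition speaks only of positive radii; here \<open>X\<close> is a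
    single point and forms one cell.\<close>
  case True
  obtain x where x: "x \<in> X"
    using assms(3) by blast
  then have X: "X = {x}"
    using D True by force
  show ?thesis
  proof (rule that[of 1 "\<lambda>_. X"])
    show "real 1 \<le> 2 powr (\<delta> * real k)"
      using ddim_le_imp_nonneg[OF assms(1,3)] by (simp add: ge_one_powr_ge_zero)
    show "disjoint_family_on (\<lambda>_. X) {..<1::nat}"
      by (auto simp: disjoint_family_on_def)
  qed (auto simp: X True)
next
  case False
  then have "D > 0"
    using assms(4) by simp
  obtain x where x: "x \<in> X"
    using assms(3) by blast
  obtain C where C: "C \<subseteq> X" "finite C" "card C \<le> nat \<lfloor>2 powr \<delta>\<rfloor> ^ k"
      "cball x D \<inter> X \<subseteq> (\<Union>c\<in>C. cball c (D / 2 ^ k))"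
    using ddim_le_imp_iterated_cover[OF assms(1) x \<open>D > 0\<close>] by blast
  define n where n: "n = card C"
  obtain c where c: "C = c ` {0..<n}"
    using ex_bij_betw_nat_finite[OF C(2)] unfolding n bij_betw_def by metis
  define B where "B i = cball (c i) (D / 2 ^ k) \<inter> X" for i
  define F where "F = disjointed B"
  show ?thesis
  proof (rule that[of n F])
    have "nat \<lfloor>2 powr \<delta>\<rfloor> \<le> 2 powr \<delta>"
      by (simp add: of_nat_nat)
    then have "real (nat \<lfloor>2 powr \<delta>\<rfloor>) ^ k \<le> (2 powr \<delta>) ^ k"
      by (intro power_mono) auto
    moreover have "(2 powr \<delta>) ^ k = 2 powr (\<delta> * real k)"
      by (simp add: powr_powr flip: powr_realpow)
    moreover have "real (n) \<le> real (nat \<lfloor>2 powr \<delta>\<rfloor>) ^ k"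
      using C(3) unfolding n by (metis of_nat_le_iff of_nat_power)
    ultimately show "real (n) \<le> 2 powr (\<delta> * real k)"
      by linarith
    show "disjoint_family_on F {..<n}"
      unfolding F_def using disjoint_family_disjointed by (rule disjoint_family_on_mono[rotated]) auto
    have "X \<subseteq> cball x D"
      using D x by auto
    then have "X \<subseteq> (\<Union>i\<in>{0..<n}. cball (c i) (D / 2 ^ k))"
      using C(4)[unfolded c] by auto
    then have "(\<Union>i\<in>{0..<n}. B i) = X"
      by (auto simp: B_def)
    then show "(\<Union>i<n. F i) = X"
      by (simp add: F_def finite_UN_disjointed_eq lessThan_atLeast0)
    have "B i \<in> sets borel" for i
      using assms(2) by (simp add: B_def borel_closed closed_Int)
    then show "F i \<in> sets borel" for i
      unfolding F_def disjointed_def by (intro sets.Diff sets.finite_UN) auto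
    fix i y z assume "y \<in> F i" "z \<in> F i"
    then have "y \<in> B i" "z \<in> B i"
      using disjointed_subset[of B i] by (auto simp: F_def)
    then show "dist y z \<le> 2 * D / 2 ^ k"
      using dist_triangle[of y z "c i"] by (simp add: B_def dist_commute)
  qed
qed

subsection \<open>Convergence rate\<close>

context
  fixes \<mu> :: "'a::{metric_space, second_countable_topology} measure"
    and P :: "'w measure"
    and X :: "nat \<Rightarrow> 'w \<Rightarrow> 'a"
    and m :: nat
  assumes \<mu>: "prob_space \<mu>" and sets: "sets \<mu> = sets borel"
    and P: "prob_space P"
    and m: "m \<ge> 1"
    and indep: "prob_space.indep_vars P (\<lambda>_. borel) X {..<m}"
    and distr: "\<And>j. j < m \<Longrightarrow> distr P borel (X j) = \<mu>"
begin

interpretation prob_space P by (rule P)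

lemma sample_measurable: "j < m \<Longrightarrow> X j \<in> borel_measurable P"
  using indep by (auto simp: indep_vars_def)

text \<open>Ensures that the cells almost surely carry the empirical measure as well as
  \<open>\<mu>\<close>.\<close>

lemma AE_sample_in:
  assumes "A \<in> sets borel" "emeasure \<mu> (- A) = 0"
  shows "AE \<omega> in P. \<forall>j<m. X j \<omega> \<in> A"
proof -
  have "AE \<omega> in P. X j \<omega> \<in> A" if "j < m" for j
  proof -
    have "AE x in \<mu>. x \<in> A"
      using assms sets by (intro AE_I[of _ _ "- A"]) auto
    then have "AE x in distr P borel (X j). x \<in> A"
      unfolding distr[OF that] .
    then show ?thesis
      using assms(1) sample_measurable[OF that] by (subst (asm) AE_distr_iff) auto
  qed
  then have "AE \<omega> in P. \<forall>j\<in>{..<m}. X j \<omega> \<in> A"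
    by (intro AE_finite_allI) auto
  then show ?thesis
    by (simp add: Ball_def)
qed

section \<open>Second moments\<close>

text \<open>The deviation is the mean of the centred indicators \<open>Z j\<close>. In the expanded
  square, independence kills the off-diagonal terms, and each of the \<open>m\<close> diagonal terms
  contributes the Bernoulli variance.\<close>

lemma empirical_measure_deviation:
  assumes A: "A \<in> sets borel"
  shows "integrable P (\<lambda>\<omega>. (measure (empirical_measure m (\<lambda>j. X j \<omega>)) A - measure \<mu> A)\<^sup>2)"
    and "expectation (\<lambda>\<omega>. (measure (empirical_measure m (\<lambda>j. X j \<omega>)) A - measure \<mu> A)\<^sup>2)
      = measure \<mu> A * (1 - measure \<mu> A) / m"
proof -
  interpret \<mu>: prob_space \<mu> by (rule \<mu>)
  define p where "p = measure \<mu> A"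
  define Z where "Z j \<omega> = indicat_real A (X j \<omega>) - p" for j \<omega>
  have Zm: "Z j \<in> borel_measurable P" if "j < m" for j
    unfolding Z_def using sample_measurable[OF that] A by measurable
  have Z_bound: "\<bar>Z j \<omega>\<bar> \<le> 1" for j \<omega>
    using \<mu>.prob_le_1[of A] measure_nonneg[of \<mu> A] by (auto simp: Z_def p_def indicator_def)
  have ZZ_int: "integrable P (\<lambda>\<omega>. Z i \<omega> * Z j \<omega>)" if "i < m" "j < m" for i j
  proof (rule integrable_const_bound[where B=1])
    show "AE \<omega> in P. norm (Z i \<omega> * Z j \<omega>) \<le> 1"
      using Z_bound by (auto simp: abs_mult mult_le_one)
  qed (use Zm that in measurable)
  have Z_int: "integrable P (Z j)" if "j < m" for j
    using Z_bound Zm[OF that] by (intro integrable_const_bound[where B=1]) auto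
  have ind_int: "integrable P (\<lambda>\<omega>. indicat_real A (X j \<omega>))" if "j < m" for j
    using sample_measurable[OF that] A by (intro integrable_const_bound[where B=1]) auto
  have ind: "expectation (\<lambda>\<omega>. indicat_real A (X j \<omega>)) = p" if "j < m" for j
  proof -
    have "expectation (\<lambda>\<omega>. indicat_real A (X j \<omega>)) = (\<integral>x. indicat_real A x \<partial>distr P borel (X j))"
      using sample_measurable[OF that] A by (intro integral_distr[symmetric]) auto
    then show ?thesis
      using distr[OF that] A sets by (simp add: p_def)
  qed
  have EZ: "expectation (Z j) = 0" if "j < m" for j
    unfolding Z_def using ind[OF that] ind_int[OF that] by (simp add: prob_space)
  have EZZ: "expectation (\<lambda>\<omega>. Z i \<omega> * Z j \<omega>) = (if i = j then p * (1 - p) else 0)"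
    if ij: "i < m" "j < m" for i j
  proof (cases "i = j")
    case True
    \<comment> \<open>The square of an indicator is the indicator, so the square is affine in
      it.\<close>
    have "Z i \<omega> * Z i \<omega> = (1 - 2 * p) * indicat_real A (X i \<omega>) + p\<^sup>2" for \<omega>
      by (auto simp: Z_def indicator_def power2_eq_square algebra_simps)
    then have "expectation (\<lambda>\<omega>. Z i \<omega> * Z i \<omega>) = (1 - 2 * p) * p + p\<^sup>2"
      using ind[OF ij(1)] ind_int[OF ij(1)] by (simp add: prob_space)
    then show ?thesis
      using True by (simp add: power2_eq_square algebra_simps)
  next
    case False
    have "indep_vars (\<lambda>_. borel) (\<lambda>j \<omega>. indicat_real A (X j \<omega>) - p) {..<m}"
      using A by (intro indep_vars_compose2[OF indep, of "\<lambda>_ x. indicat_real A x - p"]) auto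
    then have "indep_vars (\<lambda>_. borel) Z {i, j}"
      using ij unfolding Z_def by (rule_tac indep_vars_subset) auto
    then have "expectation (\<lambda>\<omega>. \<Prod>k\<in>{i, j}. Z k \<omega>) = (\<Prod>k\<in>{i, j}. expectation (Z k))"
      using Z_int ij by (intro indep_vars_lebesgue_integral) auto
    then show ?thesis
      using False EZ ij by simp
  qed
  have eq: "(measure (empirical_measure m (\<lambda>j. X j \<omega>)) A - measure \<mu> A)\<^sup>2
      = (\<Sum>i<m. \<Sum>j<m. Z i \<omega> * Z j \<omega>) / (real m)\<^sup>2" for \<omega>
  proof -
    have "measure (empirical_measure m (\<lambda>j. X j \<omega>)) A - measure \<mu> A = (\<Sum>j<m. Z j \<omega>) / m"
      unfolding measure_empirical_measure[OF A m] using m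
      by (simp add: Z_def p_def sum_subtractf field_simps)
    then show ?thesis
      by (simp add: power_divide power2_eq_square sum_product)
  qed
  show "integrable P (\<lambda>\<omega>. (measure (empirical_measure m (\<lambda>j. X j \<omega>)) A - measure \<mu> A)\<^sup>2)"
    unfolding eq using ZZ_int by (intro integrable_divide Bochner_Integration.integrable_sum) auto
  have "expectation (\<lambda>\<omega>. \<Sum>i<m. \<Sum>j<m. Z i \<omega> * Z j \<omega>)
      = (\<Sum>i<m. \<Sum>j<m. expectation (\<lambda>\<omega>. Z i \<omega> * Z j \<omega>))"
    using ZZ_int by (subst Bochner_Integration.integral_sum)
      (auto intro!: sum.cong Bochner_Integration.integral_sum Bochner_Integration.integrable_sum)
  also have "\<dots> = (\<Sum>i<m. \<Sum>j<m. if i = j then p * (1 - p) else 0)"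
    by (intro sum.cong refl) (simp add: EZZ)
  also have "\<dots> = m * (p * (1 - p))"
    by simp
  finally show "expectation (\<lambda>\<omega>. (measure (empirical_measure m (\<lambda>j. X j \<omega>)) A - measure \<mu> A)\<^sup>2)
      = measure \<mu> A * (1 - measure \<mu> A) / m"
    unfolding eq using m by (simp add: p_def power2_eq_square)
qed

text \<open>The distance takes values in [0, 1], whatever the diameter of the support.\<close>

lemma prokhorov_dist_sample_integrable:
  shows "integrable P (\<lambda>\<omega>. prokhorov_dist (empirical_measure m (\<lambda>j. X j \<omega>)) \<mu>)"
    and "integrable P (\<lambda>\<omega>. (prokhorov_dist (empirical_measure m (\<lambda>j. X j \<omega>)) \<mu>)\<^sup>2)"
proof -
  have [measurable]: "(\<lambda>\<omega>. prokhorov_dist (empirical_measure m (\<lambda>j. X j \<omega>)) \<mu>) \<in> borel_measurable P"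
    using sample_measurable by (intro borel_measurable_prokhorov_dist_empirical \<mu> m)
  have "0 \<le> prokhorov_dist (empirical_measure m x) \<mu>" "prokhorov_dist (empirical_measure m x) \<mu> \<le> 1" for x
    by (intro prokhorov_dist_nonneg prokhorov_dist_le_1 prob_space_empirical_measure \<mu> m)+
  then show "integrable P (\<lambda>\<omega>. prokhorov_dist (empirical_measure m (\<lambda>j. X j \<omega>)) \<mu>)"
    and "integrable P (\<lambda>\<omega>. (prokhorov_dist (empirical_measure m (\<lambda>j. X j \<omega>)) \<mu>)\<^sup>2)"
    by (auto intro!: integrable_const_bound[where B=1] simp: power_le_one)
qed

text \<open>Cauchy-Schwarz enters twice: it bounds the squared sum of cell deviations by
  \<open>n\<close> times the sum of their squares, and it bounds the sum of squared cell masses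
  below by \<open>1 / n\<close>. The latter gives \<open>n - 1\<close> instead of \<open>n\<close>,
  so a single cell has no sampling error.\<close>

lemma expectation_prokhorov_dist_square_le:
  assumes F: "disjoint_family_on F {..<n}" "\<And>i. F i \<in> sets borel"
    and null: "emeasure \<mu> (- (\<Union>i<n. F i)) = 0"
    and small: "\<And>i x y. i < n \<Longrightarrow> x \<in> F i \<Longrightarrow> y \<in> F i \<Longrightarrow> dist x y \<le> \<epsilon>"
    and \<epsilon>: "0 \<le> \<epsilon>"
  shows "expectation (\<lambda>\<omega>. (prokhorov_dist (empirical_measure m (\<lambda>j. X j \<omega>)) \<mu>)\<^sup>2)
    \<le> \<epsilon>\<^sup>2 + (real n - 1) / m"
proof -
  interpret \<mu>: prob_space \<mu> by (rule \<mu>)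
  let ?E = "\<lambda>\<omega>. empirical_measure m (\<lambda>j. X j \<omega>)"
  have U: "(\<Union>i<n. F i) \<in> sets borel"
    using F by (intro sets.finite_UN) auto
  have "(prokhorov_dist (?E \<omega>) \<mu>)\<^sup>2 \<le> \<epsilon>\<^sup>2 + n * (\<Sum>i<n. (measure (?E \<omega>) (F i) - measure \<mu> (F i))\<^sup>2)"
    if \<omega>: "\<forall>j<m. X j \<omega> \<in> (\<Union>i<n. F i)" for \<omega>
  proof -
    let ?S = "\<Sum>i<n. \<bar>measure (?E \<omega>) (F i) - measure \<mu> (F i)\<bar>"
    \<comment> \<open>All atoms of the empirical measure are sample points, and these lie in the
      cells.\<close>
    have "emeasure (?E \<omega>) (- (\<Union>i<n. F i)) = 0"
      using \<omega> by (subst emeasure_empirical_measure_eq[OF borel_comp[OF U] m]) (auto intro!: sum.neutral)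
    then have le: "prokhorov_dist (?E \<omega>) \<mu> \<le> max \<epsilon> ?S"
      using F small null
      by (intro prokhorov_dist_le_partition prob_space_empirical_measure \<mu> m sets \<epsilon>) auto
    have "0 \<le> prokhorov_dist (?E \<omega>) \<mu>"
      by (intro prokhorov_dist_nonneg prob_space_empirical_measure \<mu> m)
    then have "(prokhorov_dist (?E \<omega>) \<mu>)\<^sup>2 \<le> (max \<epsilon> ?S)\<^sup>2"
      by (intro power_mono le)
    also have "\<dots> \<le> \<epsilon>\<^sup>2 + ?S\<^sup>2"
      by (simp add: max_def)
    also have "?S\<^sup>2 \<le> n * (\<Sum>i<n. (measure (?E \<omega>) (F i) - measure \<mu> (F i))\<^sup>2)"
      using sum_squared_le_sum_of_squares[of "\<lambda>i. \<bar>measure (?E \<omega>) (F i) - measure \<mu> (F i)\<bar>" "{..<n}"]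
      by (simp add: mult.commute)
    finally show ?thesis
      by simp
  qed
  then have "AE \<omega> in P. (prokhorov_dist (?E \<omega>) \<mu>)\<^sup>2
      \<le> \<epsilon>\<^sup>2 + n * (\<Sum>i<n. (measure (?E \<omega>) (F i) - measure \<mu> (F i))\<^sup>2)"
    using AE_sample_in[OF U null] by (auto elim: eventually_mono)
  then have "expectation (\<lambda>\<omega>. (prokhorov_dist (?E \<omega>) \<mu>)\<^sup>2)
      \<le> expectation (\<lambda>\<omega>. \<epsilon>\<^sup>2 + n * (\<Sum>i<n. (measure (?E \<omega>) (F i) - measure \<mu> (F i))\<^sup>2))"
    using prokhorov_dist_sample_integrable(2) empirical_measure_deviation(1) F
    by (intro integral_mono_AE) (auto intro!: Bochner_Integration.integrable_sum integrable_add integrable_mult_right)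
  also have "\<dots> = \<epsilon>\<^sup>2 + n * (\<Sum>i<n. measure \<mu> (F i) * (1 - measure \<mu> (F i)) / m)"
    using empirical_measure_deviation F
    by (subst Bochner_Integration.integral_add) (auto simp: prob_space intro!: Bochner_Integration.integrable_sum integrable_mult_right)
  also have "\<dots> \<le> \<epsilon>\<^sup>2 + (real n - 1) / m"
  proof -
    have total: "(\<Sum>i<n. measure \<mu> (F i)) = 1"
    proof -
      have "(\<Sum>i<n. measure \<mu> (F i)) = measure \<mu> (\<Union>i<n. F i)"
        using F sets by (intro \<mu>.finite_measure_finite_Union[symmetric]) auto
      moreover have "measure \<mu> (space \<mu> - (\<Union>i<n. F i)) = 0"
        using null sets_eq_imp_space_eq[OF sets] by (simp add: measure_def Compl_eq_Diff_UNIV)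
      ultimately show ?thesis
        using \<mu>.prob_compl[of "\<Union>i<n. F i"] U sets by simp
    qed
    \<comment> \<open>Cauchy-Schwarz against the constant vector, with total mass 1.\<close>
    have "1 \<le> n * (\<Sum>i<n. (measure \<mu> (F i))\<^sup>2)"
      using sum_squared_le_sum_of_squares[of "\<lambda>i. measure \<mu> (F i)" "{..<n}"] total
      by (simp add: mult.commute)
    moreover have eq: "(\<Sum>i<n. measure \<mu> (F i) * (1 - measure \<mu> (F i))) = 1 - (\<Sum>i<n. (measure \<mu> (F i))\<^sup>2)"
      using total by (simp add: right_diff_distrib sum_subtractf power2_eq_square)
    ultimately have "n * (\<Sum>i<n. measure \<mu> (F i) * (1 - measure \<mu> (F i))) \<le> real n - 1"
      unfolding eq by (simp add: right_diff_distrib)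
    then show ?thesis
      by (simp add: divide_right_mono flip: sum_divide_distrib)
  qed
  finally show ?thesis .
qed

end

section \<open>Choice of the scale\<close>

text \<open>The least \<open>k\<close> with \<open>a / 2 ^ k \<le> t\<close> is positive because
  \<open>t < a\<close>, and minimality at \<open>k - 1\<close> gives the lower bound.\<close>

lemma exists_dyadic_scale:
  fixes a t :: real
  assumes "0 < t" "t < a"
  obtains k where "a / 2 ^ k \<le> t" "t < 2 * a / 2 ^ k"
proof -
  define k where "k = (LEAST k. a / 2 ^ k \<le> t)"
  obtain k0 where "a / t < 2 ^ k0"
    using real_arch_pow[of 2 "a / t"] by auto
  then have "a / 2 ^ k0 \<le> t"
    using assms by (simp add: field_simps)
  then have k: "a / 2 ^ k \<le> t"
    unfolding k_def by (rule LeastI)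
  have "k \<noteq> 0"
    using k assms by (intro notI) simp
  then obtain l where l: "k = Suc l"
    using not0_implies_Suc by blast
  then have "\<not> a / 2 ^ l \<le> t"
    using not_less_Least[of l "\<lambda>k. a / 2 ^ k \<le> t"] by (simp add: k_def)
  then show ?thesis
    using k l by (intro that[of k]) auto
qed

text \<open>At the scale \<open>t\<close> the squared cell diameter and the sampling error are each
  at most \<open>t\<^sup>2\<close>. The case distinction in \<open>t\<close> mirrors
  \<open>ennpowr\<close>, where the power with exponent 0 is 1 even for
  \<open>D = 0\<close>.\<close>

lemma expectation_prokhorov_dist_square_le_rate:
  fixes \<mu> :: "'a::{metric_space, second_countable_topology} measure"
  assumes \<mu>: "prob_space \<mu>" and sets: "sets \<mu> = sets borel"
    and P: "prob_space P" and m: "m \<ge> 1"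
    and sample: "prob_space.indep_vars P (\<lambda>_. borel) X {..<m}"
      "\<And>j. j < m \<Longrightarrow> distr P borel (X j) = \<mu>"
    and ddim: "ddim (measure_support \<mu>) \<le> ereal \<delta>"
    and D: "0 \<le> D" "\<And>x y. x \<in> measure_support \<mu> \<Longrightarrow> y \<in> measure_support \<mu> \<Longrightarrow> dist x y \<le> D"
    and t: "t = (if \<delta> = 0 then 1 else (4 * D) powr (\<delta> / (\<delta> + 2))) / m powr (1 / (\<delta> + 2))"
  shows "prob_space.expectation P (\<lambda>\<omega>. (prokhorov_dist (empirical_measure m (\<lambda>j. X j \<omega>)) \<mu>)\<^sup>2)
    \<le> 2 * t\<^sup>2"
proof -
  interpret prob_space P by fact
  let ?S = "measure_support \<mu>"
  have S: "closed ?S" "?S \<noteq> {}" "emeasure \<mu> (- ?S) = 0"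
    using emeasure_measure_support[OF \<mu> sets] emeasure_Compl_measure_support[OF sets]
    by (auto simp: closed_measure_support)
  have \<delta>: "0 \<le> \<delta>"
    using ddim_le_imp_nonneg[OF ddim S(2)] .
  have t0: "0 \<le> t"
    by (simp add: t)
  have bound: "expectation (\<lambda>\<omega>. (prokhorov_dist (empirical_measure m (\<lambda>j. X j \<omega>)) \<mu>)\<^sup>2)
      \<le> (2 * D / 2 ^ k)\<^sup>2 + (2 powr (\<delta> * real k) - 1) / m" for k
  proof -
    obtain F n where n: "real n \<le> 2 powr (\<delta> * real k)" and F: "disjoint_family_on F {..<n}" "(\<Union>i<n. F i) = ?S"
      "\<And>i. F i \<in> sets borel" "\<And>i x y. x \<in> F i \<Longrightarrow> y \<in> F i \<Longrightarrow> dist x y \<le> 2 * D / 2 ^ k"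
      using ddim_le_imp_partition[OF ddim S(1,2) D] by metis
    have "expectation (\<lambda>\<omega>. (prokhorov_dist (empirical_measure m (\<lambda>j. X j \<omega>)) \<mu>)\<^sup>2)
        \<le> (2 * D / 2 ^ k)\<^sup>2 + (real n - 1) / m"
      using F S D(1)
      by (intro expectation_prokhorov_dist_square_le[OF \<mu> sets P m sample, of F]) auto
    also have "\<dots> \<le> (2 * D / 2 ^ k)\<^sup>2 + (2 powr (\<delta> * real k) - 1) / m"
      using n by (intro add_left_mono divide_right_mono) auto
    finally show ?thesis .
  qed
  show ?thesis
  proof (cases "2 * D \<le> t")
    case True
    then have "(2 * D)\<^sup>2 \<le> t\<^sup>2"
      using D(1) by (intro power_mono) auto
    \<comment> \<open>For \<open>k = 0\<close> the sampling term vanishes. This covers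
      \<open>D = 0\<close>, where \<open>t\<close> may be 0.\<close>
    moreover have "expectation (\<lambda>\<omega>. (prokhorov_dist (empirical_measure m (\<lambda>j. X j \<omega>)) \<mu>)\<^sup>2) \<le> (2 * D)\<^sup>2"
      using bound[of 0] by simp
    ultimately show ?thesis
      using zero_le_power2[of t] by linarith
  next
    case False
    then have "D > 0"
      using t0 by linarith
    then have "t > 0"
      using m by (simp add: t)
    obtain k where k: "2 * D / 2 ^ k \<le> t" "t < 2 * (2 * D) / 2 ^ k"
      using exists_dyadic_scale[OF \<open>t > 0\<close>, of "2 * D"] False by auto
    \<comment> \<open>Raising the definition of \<open>t\<close> to the power
      \<open>\<delta> + 2\<close> gives \<open>(4 * D) powr \<delta> / m\<close>; dividing by
      \<open>t powr \<delta>\<close> gives the balance equation.\<close>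
    have t_eq: "(4 * D / t) powr \<delta> / m = t\<^sup>2"
    proof -
      have "t = (4 * D) powr (\<delta> / (\<delta> + 2)) / m powr (1 / (\<delta> + 2))"
        using \<open>D > 0\<close> by (simp add: t)
      then have "t powr (\<delta> + 2) = (4 * D) powr \<delta> / m"
        using \<delta> \<open>D > 0\<close> m by (simp add: powr_divide powr_powr)
      moreover have "t powr (\<delta> + 2) = t powr \<delta> * t\<^sup>2"
        using \<open>t > 0\<close> by (simp add: powr_add powr_numeral)
      moreover have "(4 * D / t) powr \<delta> / m = (4 * D) powr \<delta> / m / t powr \<delta>"
        using \<open>t > 0\<close> \<open>D > 0\<close> by (simp add: powr_divide)
      ultimately have "(4 * D / t) powr \<delta> / m = t powr \<delta> * t\<^sup>2 / t powr \<delta>"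
        by metis
      also have "\<dots> = t\<^sup>2"
        using \<open>t > 0\<close> by simp
      finally show ?thesis .
    qed
    \<comment> \<open>The lower bound on the scale says \<open>2 ^ k < 4 * D / t\<close>. The
      constant 4 is the factor 2 from the cell diameter times the factor 2 lost in dyadic
      rounding.\<close>
    have "2 powr (\<delta> * real k) = (2 ^ k) powr \<delta>"
      by (simp add: powr_powr mult.commute flip: powr_realpow)
    also have "\<dots> \<le> (4 * D / t) powr \<delta>"
      using k(2) \<delta> \<open>t > 0\<close> by (intro powr_mono2) (auto simp: field_simps)
    finally have "(2 powr (\<delta> * real k) - 1) / m \<le> (4 * D / t) powr \<delta> / m"
      by (intro divide_right_mono) auto
    then have "(2 powr (\<delta> * real k) - 1) / m \<le> t\<^sup>2"
      using t_eq by simp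
    moreover have "(2 * D / 2 ^ k)\<^sup>2 \<le> t\<^sup>2"
      using k(1) D(1) by (intro power_mono) auto
    ultimately show ?thesis
      using bound[of k] by linarith
  qed
qed

lemma dist_le_enn2real_ediam:
  assumes "ediam X \<noteq> \<infinity>" "x \<in> X" "y \<in> X"
  shows "dist x y \<le> enn2real (ediam X)"
proof -
  have "ennreal (dist x y) \<le> ediam X"
    unfolding ediam_def using assms by (intro SUP_upper2[OF assms(2)] SUP_upper2[OF assms(3)]) auto
  then show ?thesis
    using assms(1) enn2real_mono[of "ennreal (dist x y)" "ediam X"] by (simp add: top.not_eq_extremum)
qed

theorem theorem33:
  fixes \<mu> :: "'a::{metric_space, second_countable_topology} measure"
    and P :: "'w measure"
    and X :: "nat \<Rightarrow> 'w \<Rightarrow> 'a"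
    and m :: nat
    and \<delta> :: real
  assumes "prob_space \<mu>" and "sets \<mu> = sets borel"
    and "prob_space P"
    and "m \<ge> 1"
    and "prob_space.indep_vars P (\<lambda>_. borel) X {..<m}"
    and "\<And>j. j < m \<Longrightarrow> distr P borel (X j) = \<mu>"
    and "ddim (measure_support \<mu>) \<le> ereal \<delta>"
  shows "integrable P (\<lambda>\<omega>. prokhorov_dist (empirical_measure m (\<lambda>j. X j \<omega>)) \<mu>)
    \<and> integrable P (\<lambda>\<omega>. (prokhorov_dist (empirical_measure m (\<lambda>j. X j \<omega>)) \<mu>)\<^sup>2)
    \<and> ennreal (prob_space.expectation P
             (\<lambda>\<omega>. prokhorov_dist (empirical_measure m (\<lambda>j. X j \<omega>)) \<mu>))
           \<le> 2 * ennpowr (4 * ediam (measure_support \<mu>)) (\<delta> / (\<delta> + 2))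
             / ennreal (real m powr (1 / (\<delta> + 2)))
    \<and> ennreal (prob_space.variance P
             (\<lambda>\<omega>. prokhorov_dist (empirical_measure m (\<lambda>j. X j \<omega>)) \<mu>))
           \<le> 4 * ennpowr (4 * ediam (measure_support \<mu>)) (2 * \<delta> / (\<delta> + 2))
             / ennreal (real m powr (2 / (\<delta> + 2)))"
proof -
  interpret prob_space P by fact
  let ?S = "measure_support \<mu>"
  let ?d = "\<lambda>\<omega>. prokhorov_dist (empirical_measure m (\<lambda>j. X j \<omega>)) \<mu>"
  note int = prokhorov_dist_sample_integrable[OF assms(1-6)]
  have "?S \<noteq> {}"
    using emeasure_measure_support[OF assms(1,2)] by auto
  then have \<delta>: "0 \<le> \<delta>"
    using ddim_le_imp_nonneg[OF assms(7)] by simp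
  have "ennreal (expectation ?d) \<le> 2 * ennpowr (4 * ediam ?S) (\<delta> / (\<delta> + 2)) / ennreal (m powr (1 / (\<delta> + 2)))
    \<and> ennreal (variance ?d) \<le> 4 * ennpowr (4 * ediam ?S) (2 * \<delta> / (\<delta> + 2)) / ennreal (m powr (2 / (\<delta> + 2)))"
  proof (cases "ediam ?S = \<infinity>")
    case True
    \<comment> \<open>For positive \<open>\<delta>\<close> and infinite diameter both right-hand
      sides are infinite. For \<open>\<delta> = 0\<close> they would be finite, but then the support
      is a single point.\<close>
    have "\<delta> \<noteq> 0"
    proof
      assume "\<delta> = 0"
      then have "x = y" if "x \<in> ?S" "y \<in> ?S" for x y
        using ddim_le_0_imp_eq that assms(7) by (simp add: zero_ereal_def)
      then have "ediam ?S \<le> 0"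
        unfolding ediam_def by (intro SUP_least) (metis dist_self ennreal_0 order_refl)
      then show False
        using True by simp
    qed
    then show ?thesis
      using True \<delta> by (simp add: ennpowr_def ennreal_mult_top ennreal_top_divide)
  next
    case False
    define D where "D = enn2real (ediam ?S)"
    have D: "0 \<le> D" "ediam ?S = ennreal D"
      using False by (auto simp: D_def less_top)
    define t where "t = (if \<delta> = 0 then 1 else (4 * D) powr (\<delta> / (\<delta> + 2))) / m powr (1 / (\<delta> + 2))"
    have t0: "0 \<le> t"
      by (simp add: t_def)
    have sq: "expectation (\<lambda>\<omega>. (?d \<omega>)\<^sup>2) \<le> 2 * t\<^sup>2"
      using D(1) dist_le_enn2real_ediam[OF False]
      by (intro expectation_prokhorov_dist_square_le_rate[OF assms _ _ t_def]) (auto simp: D_def)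
    \<comment> \<open>Finite diameter and a positive denominator turn both right-hand sides into
      real expressions in \<open>t\<close>.\<close>
    have conv: "numeral c * ennpowr (4 * ediam ?S) a / ennreal b
        = ennreal (numeral c * ((if a = 0 then 1 else (4 * D) powr a) / b))" if "b > 0" for c a b
    proof -
      have "ennpowr (4 * ediam ?S) a = ennreal (if a = 0 then 1 else (4 * D) powr a)"
        using D by (simp add: ennpowr_def ennreal_mult_eq_top_iff flip: ennreal_mult' ennreal_numeral)
      then show ?thesis
        using that by (simp add: divide_ennreal flip: ennreal_mult' ennreal_numeral)
    qed
    have four_t: "(2 * t)\<^sup>2 = 4 * t\<^sup>2"
      by (simp add: power_mult_distrib)
    have var: "variance ?d = expectation (\<lambda>\<omega>. (?d \<omega>)\<^sup>2) - (expectation ?d)\<^sup>2"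
      by (rule variance_eq[OF int])
    \<comment> \<open>Variance and squared mean are nonnegative and add up to the second moment, so
      each is at most \<open>2 * t\<^sup>2\<close>.\<close>
    have "variance ?d \<le> 4 * t\<^sup>2"
      using var sq zero_le_power2[of "expectation ?d"] zero_le_power2[of t] by linarith
    moreover have "(expectation ?d)\<^sup>2 \<le> (2 * t)\<^sup>2"
      using var sq variance_positive[of ?d] zero_le_power2[of t] four_t by linarith
    then have "expectation ?d \<le> 2 * t"
      by (rule power2_le_imp_le) (simp add: t0)
    moreover have "2 * ennpowr (4 * ediam ?S) (\<delta> / (\<delta> + 2)) / ennreal (m powr (1 / (\<delta> + 2))) = ennreal (2 * t)"
      using \<delta> assms(4) by (subst conv) (auto simp: t_def)
    moreover have "4 * ennpowr (4 * ediam ?S) (2 * \<delta> / (\<delta> + 2)) / ennreal (m powr (2 / (\<delta> + 2)))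
        = ennreal (4 * t\<^sup>2)"
    proof -
      have "(4 * D) powr (2 * \<delta> / (\<delta> + 2)) = ((4 * D) powr (\<delta> / (\<delta> + 2)))\<^sup>2"
        by (simp add: power2_eq_square flip: powr_add add_divide_distrib)
      moreover have "m powr (2 / (\<delta> + 2)) = (m powr (1 / (\<delta> + 2)))\<^sup>2"
        by (simp add: power2_eq_square flip: powr_add add_divide_distrib)
      ultimately show ?thesis
        using \<delta> assms(4) by (subst conv) (auto simp: t_def power_divide)
    qed
    ultimately show ?thesis
      by (simp add: ennreal_leI)
  qed
  then show ?thesis
    using int by simp
qed

end
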